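(* No finite SSIP group is perfect.
   Context: A group $G$ is said to have the strong subgroup intersection property (is a SSIP group) if there exists a unique proper subgroup $H$ of $G$ which intersects all non-trivial subgroups of $G$ non-trivially, i.e., exactly one proper subgroup $H$ of $G$ satisfies $|X\cap H|>1$ for every non-trivial subgroup $X$ of $G$. A group $G$ is perfect if $G=G'$, where $G'$ is its commutator subgroup. *)

theory Defs
  imports "HOL-Algebra.Generated_Groups"
begin

(* The intersection contains the identity, so "non-trivially", i.e. having more than one
   element, is stated as being different from {1}. This also covers infinite intersections,
   for which card would return 0. *)
definition ssip_group :: "('a, 'b) monoid_scheme \<Rightarrow> bool" where
  "ssip_group G \<longleftrightarrow> group G \<and>
     (\<exists>!H. subgroup H G \<and> H \<noteq> carrier G \<and>
        (\<forall>X. subgroup X G \<and> X \<noteq> {\<one>\<^bsub>G\<^esub>} \<longrightarrow> X \<inter> H \<noteq> {\<one>\<^bsub>G\<^esub>}))"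

definition perfect_group :: "('a, 'b) monoid_scheme \<Rightarrow> bool" where
  "perfect_group G \<longleftrightarrow> group G \<and> derived G (carrier G) = carrier G"

end

theory Submission
  imports Defs
begin

text \<open>
  Let \<open>H\<close> be the unique proper subgroup that meets every non-trivial subgroup non-trivially.
  This property survives two operations on \<open>H\<close>, and uniqueness turns each into information.
  A conjugate of \<open>H\<close> has it again, so \<open>H\<close> equals its conjugates and is normal
  (\<open>meets_nontrivially_conjugate\<close>).  A larger proper subgroup has it again, so \<open>H\<close> is a maximal
  subgroup (\<open>meets_nontrivially_mono\<close>).

  A maximal normal subgroup need not have an abelian quotient, but one that is maximal among
  \<^emph>\<open>all\<close> subgroups does: then \<open>G/H\<close> has no proper non-trivial subgroup, so the centralizer
  of each of its non-trivial elements is everything.  Hence the commutator subgroup lies in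
  \<open>H\<close> (\<open>derived_subset_maximal_normal\<close>), which is proper, and \<open>G\<close> is not perfect.
\<close>

lemma (in group) conjugate_inv_cancel:
  assumes "g \<in> carrier G" "x \<in> carrier G"
  shows "g \<otimes> (inv g \<otimes> x \<otimes> g) \<otimes> inv g = x"
    and "inv g \<otimes> (g \<otimes> x \<otimes> inv g) \<otimes> g = x"
proof -
  have "g \<otimes> (inv g \<otimes> x) = x" "inv g \<otimes> (g \<otimes> x) = x"
    using assms by (simp_all flip: m_assoc)
  then show "g \<otimes> (inv g \<otimes> x \<otimes> g) \<otimes> inv g = x" "inv g \<otimes> (g \<otimes> x \<otimes> inv g) \<otimes> g = x"
    using assms by (simp_all add: m_assoc)
qed

lemma (in group) subgroup_conjugate:
  assumes "subgroup H G" and g: "g \<in> carrier G"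
  shows "subgroup {x \<in> carrier G. inv g \<otimes> x \<otimes> g \<in> H} G" (is "subgroup ?K G")
proof (rule subgroupI)
  interpret H: subgroup H G by fact
  show "?K \<subseteq> carrier G" by blast
  have "\<one> \<in> ?K" using g by simp
  then show "?K \<noteq> {}" by blast
  show "inv a \<in> ?K" if "a \<in> ?K" for a
  proof -
    have "inv g \<otimes> inv a \<otimes> g = inv (inv g \<otimes> a \<otimes> g)"
      using that g by (simp add: inv_mult_group m_assoc)
    then show ?thesis using that by auto
  qed
  show "a \<otimes> b \<in> ?K" if "a \<in> ?K" "b \<in> ?K" for a b
  proof -
    have "g \<otimes> (inv g \<otimes> (b \<otimes> g)) = b \<otimes> g"
      using that g by (simp flip: m_assoc)
    then have "inv g \<otimes> (a \<otimes> b) \<otimes> g = (inv g \<otimes> a \<otimes> g) \<otimes> (inv g \<otimes> b \<otimes> g)"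
      using that g by (simp add: m_assoc)
    then show ?thesis using that by auto
  qed
qed

lemma (in group_hom) subgroup_centralizer_vimage:
  assumes a: "a \<in> carrier G"
  shows "subgroup {b \<in> carrier G. h a \<otimes>\<^bsub>H\<^esub> h b = h b \<otimes>\<^bsub>H\<^esub> h a} G" (is "subgroup ?C G")
proof (rule G.subgroupI)
  show "?C \<subseteq> carrier G" by blast
  have "\<one> \<in> ?C" using a by simp
  then show "?C \<noteq> {}" by blast
  show "inv b \<in> ?C" if "b \<in> ?C" for b
  proof -
    have "(inv\<^bsub>H\<^esub> h b \<otimes>\<^bsub>H\<^esub> h a) \<otimes>\<^bsub>H\<^esub> h b = inv\<^bsub>H\<^esub> h b \<otimes>\<^bsub>H\<^esub> (h b \<otimes>\<^bsub>H\<^esub> h a)"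
      using that a by (simp add: H.m_assoc)
    also have "\<dots> = h a"
      using that a by (simp flip: H.m_assoc)
    finally have "inv\<^bsub>H\<^esub> h b \<otimes>\<^bsub>H\<^esub> h a = h a \<otimes>\<^bsub>H\<^esub> inv\<^bsub>H\<^esub> h b"
      using that a by (subst H.inv_solve_right) simp_all
    then show ?thesis using that by simp
  qed
  show "b \<otimes> c \<in> ?C" if "b \<in> ?C" "c \<in> ?C" for b c
  proof -
    have closed: "h a \<in> carrier H" "h b \<in> carrier H" "h c \<in> carrier H"
      and ab: "h a \<otimes>\<^bsub>H\<^esub> h b = h b \<otimes>\<^bsub>H\<^esub> h a" and ac: "h a \<otimes>\<^bsub>H\<^esub> h c = h c \<otimes>\<^bsub>H\<^esub> h a"
      using that a by auto
    have "h a \<otimes>\<^bsub>H\<^esub> (h b \<otimes>\<^bsub>H\<^esub> h c) = (h b \<otimes>\<^bsub>H\<^esub> h a) \<otimes>\<^bsub>H\<^esub> h c"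
      using closed by (simp only: ab flip: H.m_assoc)
    also have "\<dots> = (h b \<otimes>\<^bsub>H\<^esub> h c) \<otimes>\<^bsub>H\<^esub> h a"
      using closed by (simp only: ac H.m_assoc)
    finally show ?thesis using that by simp
  qed
qed

text \<open>
  It suffices that \<open>G/H\<close> is abelian.  Fix \<open>a\<close> in \<open>G\<close> and pull the centralizer of the coset
  \<open>Ha\<close> back to \<open>G\<close>.  The result contains both \<open>H\<close> and \<open>a\<close>, so by maximality it is \<open>G\<close>,
  unless \<open>a\<close> lies in \<open>H\<close>, and then \<open>Ha\<close> is the identity of the quotient.
  This avoids showing that the quotient is cyclic.
\<close>

lemma (in group) derived_subset_maximal_normal:
  assumes normal: "H \<lhd> G"
    and maximal: "\<And>K. subgroup K G \<Longrightarrow> H \<subseteq> K \<Longrightarrow> K = H \<or> K = carrier G"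
  shows "derived G (carrier G) \<subseteq> H"
proof -
  interpret H: normal H G by (rule normal)
  interpret Q: group "G Mod H" by (rule H.factorgroup_is_group)
  interpret \<pi>: group_hom G "G Mod H" "\<lambda>x. H #> x"
    by unfold_locales (rule H.r_coset_hom_Mod)
  have trivial_coset: "H #> h = \<one>\<^bsub>G Mod H\<^esub>" if "h \<in> H" for h
    using that H.rcos_const[OF is_group] by (simp add: FactGroup_def)
  have commute: "(H #> a) \<otimes>\<^bsub>G Mod H\<^esub> (H #> b) = (H #> b) \<otimes>\<^bsub>G Mod H\<^esub> (H #> a)"
    if a: "a \<in> carrier G" and b: "b \<in> carrier G" for a b
  proof (cases "a \<in> H")
    case True
    then show ?thesis
      by (simp only: trivial_coset Q.l_one[OF \<pi>.hom_closed[OF b]] Q.r_one[OF \<pi>.hom_closed[OF b]])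
  next
    case False
    let ?C = "{b \<in> carrier G. (H #> a) \<otimes>\<^bsub>G Mod H\<^esub> (H #> b) = (H #> b) \<otimes>\<^bsub>G Mod H\<^esub> (H #> a)}"
    have "h \<in> ?C" if "h \<in> H" for h
      using H.mem_carrier[OF that]
      by (simp only: mem_Collect_eq trivial_coset[OF that]
          Q.l_one[OF \<pi>.hom_closed[OF a]] Q.r_one[OF \<pi>.hom_closed[OF a]])
    then have "H \<subseteq> ?C" by (rule subsetI)
    moreover have "a \<in> ?C" using a by simp
    ultimately have "?C = carrier G"
      using maximal[OF \<pi>.subgroup_centralizer_vimage[OF a]] False by blast
    then show ?thesis using b by blast
  qed
  have "comm_group (G Mod H)"
  proof (rule Q.group_comm_groupI)
    fix X Y assume "X \<in> carrier (G Mod H)" "Y \<in> carrier (G Mod H)"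
    then obtain a b where "a \<in> carrier G" "X = H #> a" "b \<in> carrier G" "Y = H #> b"
      by (auto simp: FactGroup_def RCOSETS_def)
    then show "X \<otimes>\<^bsub>G Mod H\<^esub> Y = Y \<otimes>\<^bsub>G Mod H\<^esub> X" using commute by blast
  qed
  then show ?thesis using derived_minimal normal by blast
qed

definition meets_nontrivially :: "('a, 'b) monoid_scheme \<Rightarrow> 'a set \<Rightarrow> bool" where
  "meets_nontrivially G H \<longleftrightarrow>
     (\<forall>X. subgroup X G \<and> X \<noteq> {\<one>\<^bsub>G\<^esub>} \<longrightarrow> X \<inter> H \<noteq> {\<one>\<^bsub>G\<^esub>})"

lemma (in group) meets_nontrivially_mono:
  assumes "meets_nontrivially G H" "subgroup H G" "H \<subseteq> K"
  shows "meets_nontrivially G K"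
  unfolding meets_nontrivially_def
proof (intro allI impI)
  fix X assume X: "subgroup X G \<and> X \<noteq> {\<one>}"
  then have "X \<inter> H \<noteq> {\<one>}" using assms(1) unfolding meets_nontrivially_def by blast
  moreover have "\<one> \<in> X \<inter> H" using X assms(2) by (simp add: subgroup.one_closed)
  ultimately show "X \<inter> K \<noteq> {\<one>}" using assms(3) by blast
qed

text \<open>
  Conjugation is an automorphism: \<open>X\<close> meets the conjugate of \<open>H\<close> in the image of what the
  inversely conjugated \<open>X\<close> has in common with \<open>H\<close>.
\<close>

lemma (in group) meets_nontrivially_conjugate:
  assumes meets: "meets_nontrivially G H" and H: "subgroup H G" and g: "g \<in> carrier G"
  shows "meets_nontrivially G {x \<in> carrier G. inv g \<otimes> x \<otimes> g \<in> H}"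
  unfolding meets_nontrivially_def
proof (intro allI impI)
  fix X assume X: "subgroup X G \<and> X \<noteq> {\<one>}"
  let ?Y = "{x \<in> carrier G. g \<otimes> x \<otimes> inv g \<in> X}"
  have Y: "subgroup ?Y G" using subgroup_conjugate[of X "inv g"] X g by simp
  have "\<one> \<in> X" using X by (simp add: subgroup.one_closed)
  then obtain x where x: "x \<in> X" "x \<noteq> \<one>" using X by blast
  have xG: "x \<in> carrier G" using subgroup.mem_carrier[of X G x] X x(1) by simp
  have "inv g \<otimes> x \<otimes> g \<in> ?Y" using x xG g by (simp add: conjugate_inv_cancel)
  moreover have "inv g \<otimes> x \<otimes> g \<noteq> \<one>"
  proof
    assume "inv g \<otimes> x \<otimes> g = \<one>"
    then have "g \<otimes> \<one> \<otimes> inv g = x" using conjugate_inv_cancel(1)[OF g xG] by (simp only:)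
    then show False using x g by simp
  qed
  ultimately have "?Y \<noteq> {\<one>}" by blast
  then have "?Y \<inter> H \<noteq> {\<one>}" using meets Y unfolding meets_nontrivially_def by blast
  moreover have "\<one> \<in> ?Y \<inter> H" using subgroup.one_closed[OF Y] subgroup.one_closed[OF H] by blast
  ultimately obtain y where y: "y \<in> ?Y" "y \<in> H" "y \<noteq> \<one>" by blast
  have "g \<otimes> y \<otimes> inv g \<in> X \<inter> {x \<in> carrier G. inv g \<otimes> x \<otimes> g \<in> H}"
    using y g by (simp add: conjugate_inv_cancel)
  moreover have "g \<otimes> y \<otimes> inv g \<noteq> \<one>"
  proof
    assume "g \<otimes> y \<otimes> inv g = \<one>"
    moreover have "inv g \<otimes> (g \<otimes> y \<otimes> inv g) \<otimes> g = y"
      using y(1) by (intro conjugate_inv_cancel(2)[OF g]) blast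
    ultimately have "inv g \<otimes> \<one> \<otimes> g = y" by (simp only:)
    then show False using y(3) g by simp
  qed
  ultimately show "X \<inter> {x \<in> carrier G. inv g \<otimes> x \<otimes> g \<in> H} \<noteq> {\<one>}" by blast
qed

lemma (in group) unique_meets_nontrivially_imp_normal:
  assumes H: "subgroup H G" and proper: "H \<noteq> carrier G" and meets: "meets_nontrivially G H"
    and unique: "\<And>K. \<lbrakk>subgroup K G; K \<noteq> carrier G; meets_nontrivially G K\<rbrakk> \<Longrightarrow> K = H"
  shows "H \<lhd> G"
proof -
  have conjugate: "inv g \<otimes> h \<otimes> g \<in> H" if g: "g \<in> carrier G" and h: "h \<in> H" for g h
  proof -
    let ?K = "{x \<in> carrier G. inv g \<otimes> x \<otimes> g \<in> H}"
    have "?K \<noteq> carrier G"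
    proof
      assume all: "?K = carrier G"
      have "x \<in> H" if x: "x \<in> carrier G" for x
      proof -
        have "g \<otimes> x \<otimes> inv g \<in> ?K" using all x g by simp
        moreover have "inv g \<otimes> (g \<otimes> x \<otimes> inv g) \<otimes> g = x"
          using x g by (simp add: conjugate_inv_cancel)
        ultimately show ?thesis by simp
      qed
      then show False using proper subgroup.subset[OF H] by blast
    qed
    then have "?K = H"
      using unique subgroup_conjugate[OF H g] meets_nontrivially_conjugate[OF meets H g] by blast
    then show ?thesis using h by blast
  qed
  show "H \<lhd> G"
  proof (rule normal_invI[OF H])
    fix g h assume "g \<in> carrier G" "h \<in> H"
    then show "g \<otimes> h \<otimes> inv g \<in> H" using conjugate[of "inv g" h] by simp
  qed
qed

theorem proposition4p3:
  fixes G :: "('a, 'b) monoid_scheme"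
  assumes "finite (carrier G)" and "ssip_group G"
  shows "\<not> perfect_group G"
proof -
  interpret group G using assms(2) by (simp add: ssip_group_def)
  have "\<exists>!H. subgroup H G \<and> H \<noteq> carrier G \<and> meets_nontrivially G H"
    using assms(2) by (simp add: ssip_group_def meets_nontrivially_def)
  then obtain H where conj: "subgroup H G \<and> H \<noteq> carrier G \<and> meets_nontrivially G H"
    and only: "\<forall>K. subgroup K G \<and> K \<noteq> carrier G \<and> meets_nontrivially G K \<longrightarrow> K = H"
    by (elim ex1E)
  from conj have H: "subgroup H G" and proper: "H \<noteq> carrier G" and meets: "meets_nontrivially G H"
    by simp_all
  have unique: "K = H" if "subgroup K G" "K \<noteq> carrier G" "meets_nontrivially G K" for K
    using only that by blast
  have maximal: "K = H \<or> K = carrier G" if "subgroup K G" "H \<subseteq> K" for K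
    using unique that meets_nontrivially_mono[OF meets H] by blast
  have "H \<lhd> G"
    using unique_meets_nontrivially_imp_normal[OF H proper meets unique] .
  then have "derived G (carrier G) \<subseteq> H"
    using derived_subset_maximal_normal maximal by blast
  then show ?thesis
    using proper subgroup.subset[OF H] unfolding perfect_group_def by blast
qed

end
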